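(* Let $\alpha=[\overline{a_0,a_1,\dots,a_{l-1}}]$ be a periodic continued fraction of even period $l$ with positive integer terms, let $\bar\alpha$ be its Galois conjugate, let $r_n$ be the $n$-th convergent of $\alpha$ (with $r_{-1}=\infty$), let $\alpha^{(k)}=[\overline{a_k,a_{k+1},\dots,a_{k-1}}]$ be the $k$-th cyclic permutation of $\alpha$, and let $p^{(k)}(s)/q^{(k)}(s)$ be the $s$-th convergent of $\alpha^{(k)}$. Then $$\begin{aligned}&\mathop{\sum\sum}_{0\le j<i\le l/2-1}\mathcal{L}\left(\frac{a_{2i+1}a_{2j+1}}{p^{(2j+1)}(2i-2j-2)\,p^{(2j+3)}(2i-2j-2)}\right)\\&\quad+\sum_{j=0}^{l/2-1}\sum_{i=0}^{l/2-1}\sum_{k=1}^{\infty}\mathcal{L}\left(\frac{a_{2i+1}a_{2j+1}}{p^{(2j+1)}(kl+2i-2j-2)\,p^{(2j+3)}(kl+2i-2j-2)}\right)\\&\quad+\sum_{m=0}^{l/2-1}\mathcal{L}\bigl([\bar\alpha,\alpha,r_{2m+1},r_{2m-1}]\bigr)=\frac{\pi^2 l}{6}.\end{aligned}$$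
   Context: The Rogers dilogarithm is the function on $[0,1]$ given by $\mathcal{L}(z)=\mathrm{Li}_2(z)+\frac12\log|z|\log(1-z)$, where $\mathrm{Li}_2(z)=\sum_{n\ge1}z^n/n^2$, with $\mathcal{L}(0)=0$ and $\mathcal{L}(1)=\pi^2/6$. The cross ratio of four points of $\hat{\mathbb{C}}$ (at least three distinct) is $[z_1,z_2,z_3,z_4]=\frac{(z_1-z_2)(z_4-z_3)}{(z_1-z_3)(z_4-z_2)}$, with the usual convention when one of the points is $\infty$ (the factors containing $\infty$ are cancelled by taking the limit). For positive integers $a_0,a_1,\dots$, $[a_0,a_1,a_2,\dots]=a_0+\cfrac{1}{a_1+\cfrac{1}{a_2+\cdots}}$; $[\overline{a_0,\dots,a_{l-1}}]$ denotes the continued fraction with $a_{n+l}=a_n$ for all $n\ge0$. Its convergents $r_n=p_n/q_n$ are given by $p_n=a_np_{n-1}+p_{n-2}$, $q_n=a_nq_{n-1}+q_{n-2}$ ($n\ge0$), with $(p_{-2},p_{-1})=(0,1)$, $(q_{-2},q_{-1})=(1,0)$; thus $r_{-2}=0$, $r_{-1}=\infty$. The period $l$ need not be minimal. The $k$-th cyclic permutation of $\alpha$ is the continued fraction $\alpha^{(k)}=[a_k,a_{k+1},a_{k+2},\dots]$ (indices of the $a$'s read modulo $l$), and $p^{(k)}(s)/q^{(k)}(s)$ is its $s$-th convergent; explicitly $p^{(k)}(-2)=0$, $p^{(k)}(-1)=1$, $p^{(k)}(s)=a_{k+s}\,p^{(k)}(s-1)+p^{(k)}(s-2)$ for $s\ge0$.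 *)

theory Defs
  imports
    "HOL-Analysis.Analysis"
    "HOL-Computational_Algebra.Computational_Algebra"
begin

section \<open>The Rogers dilogarithm\<close>

definition dilog :: "real \<Rightarrow> real" where
  "dilog z = (\<Sum>n. z ^ Suc n / (real (Suc n))\<^sup>2)"

text \<open>Only the values on the closed unit interval are meaningful.\<close>

definition rogers_L :: "real \<Rightarrow> real" where
  "rogers_L z =
     (if z = 0 then 0
      else if z = 1 then pi\<^sup>2 / 6
      else dilog z + 1/2 * ln \<bar>z\<bar> * ln (1 - z))"


section \<open>Cross ratios\<close>

datatype 'a proj = Fin 'a | Infty

text \<open>
  \<open>pdiff z w\<close> is \<open>x * v - u * y\<close> for the homogeneous coordinates \<open>z = (x : y)\<close>,
  \<open>w = (u : v)\<close>, normalised to \<open>(z : 1)\<close> at a finite point and to \<open>(1 : 0)\<close> at infinity.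
  Each argument of the cross ratio occurs in exactly one factor of the numerator and one of the
  denominator, so using \<open>pdiff\<close> in place of subtraction is the same as cancelling the factors
  containing the point at infinity in the limit (see \<open>cross_ratio_Infty\<close>).
\<close>

fun pdiff :: "'a::field proj \<Rightarrow> 'a proj \<Rightarrow> 'a" where
  "pdiff (Fin z) (Fin w) = z - w"
| "pdiff Infty (Fin w) = 1"
| "pdiff (Fin z) Infty = -1"
| "pdiff Infty Infty = 0"

text \<open>
  For at least three distinct points the cross ratio is infinite exactly if \<open>z1 = z3\<close> or
  \<open>z4 = z2\<close>; only in this case does the division below return a dummy value.
\<close>

definition cross_ratio :: "'a::field proj \<Rightarrow> 'a proj \<Rightarrow> 'a proj \<Rightarrow> 'a proj \<Rightarrow> 'a" where
  "cross_ratio z1 z2 z3 z4 =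
     (pdiff z1 z2 * pdiff z4 z3) / (pdiff z1 z3 * pdiff z4 z2)"

lemma cross_ratio_Infty:
  "cross_ratio Infty (Fin z2) (Fin z3) (Fin z4) = (z4 - z3) / (z4 - z2)"
  "cross_ratio (Fin z1) Infty (Fin z3) (Fin z4) = (z4 - z3) / (z1 - z3)"
  "cross_ratio (Fin z1) (Fin z2) Infty (Fin z4) = (z1 - z2) / (z4 - z2)"
  "cross_ratio (Fin z1) (Fin z2) (Fin z3) Infty = (z1 - z2) / (z1 - z3)"
  by (simp_all add: cross_ratio_def) (metis minus_diff_eq minus_divide_divide)+


section \<open>Continued fractions\<close>

primrec cf_trunc :: "nat \<Rightarrow> (nat \<Rightarrow> nat) \<Rightarrow> real" where
  "cf_trunc 0 a = real (a 0)"
| "cf_trunc (Suc n) a = real (a 0) + 1 / cf_trunc n (\<lambda>i. a (Suc i))"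

definition cf_value :: "(nat \<Rightarrow> nat) \<Rightarrow> real" where
  "cf_value a = lim (\<lambda>n. cf_trunc n a)"

text \<open>
  Numerators and denominators of the convergents start at index \<open>-2\<close>; the recursive functions
  are shifted by 2, so that e.g. \<open>cf_num_shift a n\<close> is \<open>cf_p a (int n - 2)\<close>.
\<close>

fun cf_num_shift :: "(nat \<Rightarrow> nat) \<Rightarrow> nat \<Rightarrow> nat" where
  "cf_num_shift a 0 = 0"
| "cf_num_shift a (Suc 0) = 1"
| "cf_num_shift a (Suc (Suc n)) = a n * cf_num_shift a (Suc n) + cf_num_shift a n"

fun cf_den_shift :: "(nat \<Rightarrow> nat) \<Rightarrow> nat \<Rightarrow> nat" where
  "cf_den_shift a 0 = 1"
| "cf_den_shift a (Suc 0) = 0"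
| "cf_den_shift a (Suc (Suc n)) = a n * cf_den_shift a (Suc n) + cf_den_shift a n"

definition cf_p :: "(nat \<Rightarrow> nat) \<Rightarrow> int \<Rightarrow> nat" where
  "cf_p a s = cf_num_shift a (nat (s + 2))"

definition cf_q :: "(nat \<Rightarrow> nat) \<Rightarrow> int \<Rightarrow> nat" where
  "cf_q a s = cf_den_shift a (nat (s + 2))"

definition convergent_pt :: "(nat \<Rightarrow> nat) \<Rightarrow> int \<Rightarrow> real proj" where
  "convergent_pt a s =
     (if cf_q a s = 0 then Infty else Fin (real (cf_p a s) / real (cf_q a s)))"

text \<open>
  For \<open>a\<close> of period \<open>l\<close> this is the \<open>k\<close>-th cyclic permutation, the indices being read
  modulo \<open>l\<close> automatically.
\<close>

definition cf_cyc :: "nat \<Rightarrow> (nat \<Rightarrow> nat) \<Rightarrow> nat \<Rightarrow> nat" where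
  "cf_cyc k a = (\<lambda>n. a (k + n))"


section \<open>Galois conjugates of real quadratic irrationals\<close>

definition galois_conj :: "real \<Rightarrow> real" where
  "galois_conj x =
     (THE y. y \<noteq> x \<and>
        (\<exists>f :: rat poly. irreducible f \<and> degree f = 2 \<and>
           poly (map_poly of_rat f) x = 0 \<and> poly (map_poly of_rat f) y = 0))"


section \<open>The arguments of the dilogarithm\<close>

definition dilog_arg :: "(nat \<Rightarrow> nat) \<Rightarrow> nat \<Rightarrow> nat \<Rightarrow> int \<Rightarrow> real" where
  "dilog_arg a i j s =
     real (a (2*i+1) * a (2*j+1)) /
     real (cf_p (cf_cyc (2*j+1) a) s * cf_p (cf_cyc (2*j+3) a) s)"

end

theory Submission
  imports Defs "HOL-Real_Asymp.Real_Asymp"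
begin

text \<open>
  The odd convergents are the vertices of an infinite ideal polygon running from \<open>\<alpha>'\<close> to \<open>\<alpha>\<close>,
  invariant under the automorphism \<open>g\<close> with these fixed points; \<open>g\<close> shifts the vertices by \<open>l/2\<close>.
  The first two sums run over the pairs of its edges modulo \<open>g\<close>, the third over the pairs of
  an edge and the axis of \<open>g\<close>. Apply the five-term relation to the pentagon spanned by \<open>\<alpha>'\<close> and
  two edges, fix the first edge \<open>j\<close> and sum over the second edge \<open>i > j\<close>. One family of terms
  telescopes in \<open>i\<close>, and its limit is the term for the axis. The rest is a function of \<open>j\<close> minus
  its value at \<open>j + 1\<close>, which cancels on summing over a period. With \<open>\<alpha>'\<close> at infinity and
  \<open>\<alpha>\<close> at \<open>0\<close>, the vertices form a decreasing real sequence \<open>t\<close> with \<open>t (i + l/2) = \<mu> t i\<close>.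
\<close>

section \<open>Functional equations of the Rogers dilogarithm\<close>

lemma dilog_summable:
  assumes "0 \<le> z" "z \<le> 1"
  shows "summable (\<lambda>n. z ^ Suc n / (real (Suc n))\<^sup>2)"
proof (rule summable_comparison_test')
  show "summable (\<lambda>n. 1 / (real (Suc n))\<^sup>2)"
    using inverse_squares_sums by (simp add: sums_iff add.commute)
  show "norm (z ^ Suc n / (real (Suc n))\<^sup>2) \<le> 1 / (real (Suc n))\<^sup>2" for n
    using assms power_le_one[of z "Suc n"] by (simp add: divide_right_mono abs_mult)
qed

lemma dilog_0 [simp]: "dilog 0 = 0"
  by (simp add: dilog_def)

lemma dilog_1: "dilog 1 = pi\<^sup>2 / 6"
  using inverse_squares_sums by (simp add: sums_iff dilog_def add.commute)

lemma dilog_nonneg: "0 \<le> z \<Longrightarrow> z \<le> 1 \<Longrightarrow> 0 \<le> dilog z"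
  unfolding dilog_def by (intro suminf_nonneg dilog_summable) auto

lemma continuous_on_dilog: "continuous_on {0..1} dilog"
proof -
  have "uniform_limit {0..1} (\<lambda>n z. \<Sum>i<n. z ^ Suc i / (real (Suc i))\<^sup>2) dilog sequentially"
    unfolding dilog_def
  proof (rule Weierstrass_m_test)
    show "summable (\<lambda>n. 1 / (real (Suc n))\<^sup>2)"
      using inverse_squares_sums by (simp add: sums_iff add.commute)
    show "norm (z ^ Suc n / (real (Suc n))\<^sup>2) \<le> 1 / (real (Suc n))\<^sup>2"
      if "z \<in> {0..1}" for n z
      using that power_le_one[of z "Suc n"] by (simp add: divide_right_mono abs_mult)
  qed
  then show ?thesis
    by (rule uniform_limit_theorem[rotated]) (auto intro!: always_eventually continuous_intros)
qed

lemma has_real_derivative_dilog: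
  assumes "0 < z" "z < 1"
  shows "(dilog has_real_derivative - ln (1 - z) / z) (at z)"
proof -
  \<comment> \<open>Division by zero gives \<open>c 0 = 0\<close>, so indexing from 0 turns the sum
    into a power series without changing its value.\<close>
  define c :: "nat \<Rightarrow> real" where "c n = 1 / (real n)\<^sup>2" for n
  have eq: "c (Suc n) * w ^ Suc n = w ^ Suc n / (real (Suc n))\<^sup>2" for n w
    by (simp add: c_def)
  have summ: "summable (\<lambda>n. c n * w ^ n)" if "0 \<le> w" "w \<le> 1" for w
    using dilog_summable[OF that] unfolding eq[symmetric] by (subst (asm) summable_Suc_iff)
  have "((\<lambda>w. \<Sum>n. c n * w ^ n) has_real_derivative (\<Sum>n. diffs c n * z ^ n)) (at z)"
    using assms summ[of 1] by (intro termdiffs_strong[where K = 1]) auto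
  moreover have "(\<Sum>n. diffs c n * z ^ n) = - ln (1 - z) / z"
  proof -
    have "ln (1 - z) = (\<Sum>n. (-1) ^ n * (1 / real (n + 1)) * (1 - z - 1) ^ Suc n)"
      using assms by (intro ln_series) auto
    also have "(\<lambda>n. (-1) ^ n * (1 / real (n + 1)) * (1 - z - 1) ^ Suc n)
        = (\<lambda>n. (- z) * (diffs c n * z ^ n))"
    proof
      fix n
      have "(-1) ^ n * (- z) ^ n = z ^ n"
        by (simp flip: power_mult_distrib)
      moreover have "diffs c n = 1 / real (n + 1)"
        by (simp add: diffs_def c_def power2_eq_square)
      ultimately show "(-1) ^ n * (1 / real (n + 1)) * (1 - z - 1) ^ Suc n = (- z) * (diffs c n * z ^ n)"
        by simp
    qed
    also have "suminf \<dots> = (- z) * (\<Sum>n. diffs c n * z ^ n)"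
      using assms
      by (intro suminf_mult termdiff_converges[of z 1] powser_inside[OF summ[of 1]]) auto
    finally show ?thesis using assms by (simp add: field_simps)
  qed
  ultimately have "((\<lambda>w. \<Sum>n. c n * w ^ n) has_real_derivative - ln (1 - z) / z) (at z)"
    by simp
  then show ?thesis
  proof (rule has_field_derivative_transform_within_open[where S = "{0<..<1}"])
    show "(\<Sum>n. c n * w ^ n) = dilog w" if "w \<in> {0<..<1}" for w
      using suminf_split_head[OF summ[of w]] that unfolding dilog_def eq by (simp add: c_def)
  qed (use assms in auto)
qed

text \<open>At both endpoints one of the logarithm factors is \<open>ln 1 = 0\<close>, and the
  exceptional values of \<open>rogers_L\<close> are those of \<open>dilog\<close>.\<close>

lemma rogers_L_eq:
  assumes "0 \<le> z" "z \<le> 1"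
  shows "rogers_L z = dilog z + 1/2 * ln z * ln (1 - z)"
  using assms by (auto simp: rogers_L_def dilog_1)

lemma rogers_L_0 [simp]: "rogers_L 0 = 0"
  and rogers_L_1 [simp]: "rogers_L 1 = pi\<^sup>2 / 6"
  by (simp_all add: rogers_L_def)

lemma rogers_L_nonneg:
  assumes "0 \<le> z" "z \<le> 1"
  shows "0 \<le> rogers_L z"
proof -
  have "0 \<le> ln z * ln (1 - z)" if "0 < z" "z < 1"
    using that by (intro mult_nonpos_nonpos) auto
  then have "0 \<le> ln z * ln (1 - z)"
    using assms by (cases "z = 0 \<or> z = 1") auto
  then show ?thesis
    using dilog_nonneg[OF assms] by (simp add: rogers_L_eq[OF assms])
qed

text \<open>Only the endpoints need care: one logarithm diverges there while the other vanishes to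
  first order, so their product tends to 0.\<close>

lemma continuous_on_rogers_L: "continuous_on {0..1} rogers_L"
proof -
  have "continuous (at z within {0..1}) (\<lambda>z. ln z * ln (1 - z))" if z: "z \<in> {0..1}" for z :: real
  proof -
    consider "z = 0" | "z = 1" | "0 < z" "z < 1" using z by fastforce
    then show ?thesis
    proof cases
      case 1
      have "((\<lambda>z::real. ln z * ln (1 - z)) \<longlongrightarrow> 0) (at_right 0)" by real_asymp
      with 1 show ?thesis by (simp add: continuous_within at_within_Icc_at_right)
    next
      case 2
      have "((\<lambda>z::real. ln z * ln (1 - z)) \<longlongrightarrow> 0) (at_left 1)" by real_asymp
      with 2 show ?thesis by (simp add: continuous_within at_within_Icc_at_left)
    next
      case 3
      then show ?thesis by (intro continuous_intros) auto
    qed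
  qed
  then have "continuous_on {0..1} (\<lambda>z::real. ln z * ln (1 - z))"
    by (simp add: continuous_on_eq_continuous_within)
  then have "continuous_on {0..1} (\<lambda>z. dilog z + 1/2 * (ln z * ln (1 - z)))"
    by (intro continuous_on_add continuous_on_dilog continuous_on_mult_left)
  then show ?thesis
    by (rule continuous_on_eq) (simp add: rogers_L_eq)
qed

section \<open>The derivative of the Rogers dilogarithm and the functional equations it
  yields\<close>

lemma has_real_derivative_rogers_L:
  assumes "0 < z" "z < 1"
  shows "(rogers_L has_real_derivative - (ln (1 - z) / z + ln z / (1 - z)) / 2) (at z)"
proof -
  have "((\<lambda>z. dilog z + 1/2 * ln z * ln (1 - z)) has_real_derivative
      - (ln (1 - z) / z + ln z / (1 - z)) / 2) (at z)"
    using assms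
    by (auto intro!: derivative_eq_intros has_real_derivative_dilog simp: field_simps)
  then show ?thesis
    by (rule has_field_derivative_transform_within_open[where S = "{0<..<1}"])
      (use assms in \<open>auto simp: rogers_L_eq\<close>)
qed

text \<open>The derivative of \<open>rogers_L\<close> is symmetric under exchanging \<open>z\<close>
  and \<open>1 - z\<close>, so the sum is constant and equals its value at 0.\<close>

lemma rogers_L_reflect:
  assumes "0 \<le> x" "x \<le> 1"
  shows "rogers_L x + rogers_L (1 - x) = pi\<^sup>2 / 6"
proof (cases "x = 0")
  case False
  let ?g = "\<lambda>x. rogers_L x + rogers_L (1 - x)"
  have "?g x = ?g 0"
  proof (rule DERIV_isconst_end[where f = ?g])
    show "0 < x" using False assms by simp
    show "continuous_on {0..x} ?g"
      using assms
      by (intro continuous_intros continuous_on_compose2[OF continuous_on_rogers_L]) auto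
    show "(?g has_real_derivative 0) (at z)" if "0 < z" "z < x" for z
      using that assms
      by (auto intro!: derivative_eq_intros DERIV_chain2[OF has_real_derivative_rogers_L])
  qed
  then show ?thesis by simp
qed simp

text \<open>With \<open>y\<close> fixed, the difference of the two sides has derivative 0 in
  \<open>x\<close>. At \<open>x = 0\<close> both sides reduce to \<open>rogers_L y\<close>.\<close>

lemma rogers_L_five_term:
  assumes x: "0 < x" "x < 1" and y: "0 < y" "y < 1"
  shows "rogers_L x + rogers_L y =
    rogers_L (x * y) + rogers_L (x * (1 - y) / (1 - x * y)) + rogers_L (y * (1 - x) / (1 - x * y))"
proof -
  let ?g = "\<lambda>x. rogers_L x + rogers_L y - (rogers_L (x * y) +
    rogers_L (x * (1 - y) / (1 - x * y)) + rogers_L (y * (1 - x) / (1 - x * y)))"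
  have nz: "z * y < 1" if "0 \<le> z" "z \<le> x" for z
    using that assms mult_strict_mono'[of z 1 y 1] by auto
  \<comment> \<open>The derivative of \<open>rogers_L\<close> at an argument involves the logarithm
    of its complement, so the complements are needed in factored form.\<close>
  have u1: "1 - z * (1 - y) / (1 - z * y) = (1 - z) / (1 - z * y)"
    and v1: "1 - y * (1 - z) / (1 - z * y) = (1 - y) / (1 - z * y)" if "0 \<le> z" "z \<le> x" for z
    using nz[OF that] by (simp_all add: field_simps)
  have u: "0 \<le> z * (1 - y) / (1 - z * y)" "z * (1 - y) / (1 - z * y) \<le> 1"
    and v: "0 \<le> y * (1 - z) / (1 - z * y)" "y * (1 - z) / (1 - z * y) \<le> 1"
    if "0 \<le> z" "z \<le> x" for z
  proof -
    have "0 \<le> (1 - z) / (1 - z * y)" "0 \<le> (1 - y) / (1 - z * y)"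
      using nz[OF that] that assms by (intro divide_nonneg_pos; simp)+
    then show "z * (1 - y) / (1 - z * y) \<le> 1" "y * (1 - z) / (1 - z * y) \<le> 1"
      using u1[OF that] v1[OF that] by linarith+
    show "0 \<le> z * (1 - y) / (1 - z * y)" "0 \<le> y * (1 - z) / (1 - z * y)"
      using nz[OF that] that assms by (intro divide_nonneg_pos; simp)+
  qed
  have "?g x = ?g 0"
  proof (rule DERIV_isconst_end[where f = ?g])
    show "0 < x" by fact
    show "continuous_on {0..x} ?g"
      using assms u v nz
      by (intro continuous_intros continuous_on_compose2[OF continuous_on_rogers_L])
        (force intro: less_imp_le)+
    show "(?g has_real_derivative 0) (at z)" if z: "0 < z" "z < x" for z
    proof -
      define w where "w = 1 - z * y"
      have w: "0 < w" using nz[of z] z by (simp add: w_def)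
      have lnu: "ln (z * (1 - y) / w) = ln z + ln (1 - y) - ln w"
        and lnv: "ln (y * (1 - z) / w) = ln y + ln (1 - z) - ln w"
        and lnu': "ln ((1 - z) / w) = ln (1 - z) - ln w"
        and lnv': "ln ((1 - y) / w) = ln (1 - y) - ln w"
        and lnzy: "ln (z * y) = ln z + ln y"
        using z assms w by (simp_all add: ln_div ln_mult)
      have upos: "0 < z * (1 - y) / w" "0 < y * (1 - z) / w" "0 < (1 - z) / w" "0 < (1 - y) / w"
        using z assms w by simp_all
      have ud: "((\<lambda>z. z * (1 - y) / (1 - z * y)) has_real_derivative (1 - y) / w\<^sup>2) (at z)"
        using w unfolding w_def
        by (auto intro!: derivative_eq_intros simp: field_simps power2_eq_square)
      have vd: "((\<lambda>z. y * (1 - z) / (1 - z * y)) has_real_derivative - (y * (1 - y)) / w\<^sup>2) (at z)"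
        using w unfolding w_def
        by (auto intro!: derivative_eq_intros simp: field_simps power2_eq_square)
      have du: "((\<lambda>z. rogers_L (z * (1 - y) / (1 - z * y))) has_real_derivative
          - (ln ((1 - z) / w) / (z * (1 - y) / w) + ln (z * (1 - y) / w) / ((1 - z) / w)) / 2
            * ((1 - y) / w\<^sup>2)) (at z)"
        using DERIV_chain2[OF has_real_derivative_rogers_L ud] upos u1[of z] z
        unfolding w_def by auto
      have dv: "((\<lambda>z. rogers_L (y * (1 - z) / (1 - z * y))) has_real_derivative
          - (ln ((1 - y) / w) / (y * (1 - z) / w) + ln (y * (1 - z) / w) / ((1 - y) / w)) / 2
            * (- (y * (1 - y)) / w\<^sup>2)) (at z)"
        using DERIV_chain2[OF has_real_derivative_rogers_L vd] upos v1[of z] z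
        unfolding w_def by auto
      have dp: "((\<lambda>z. rogers_L (z * y)) has_real_derivative
          - (ln w / (z * y) + ln (z * y) / w) / 2 * y) (at z)"
        using z assms w unfolding w_def
        by (intro DERIV_chain2[OF has_real_derivative_rogers_L]) (auto intro!: derivative_eq_intros)
      have dz: "(rogers_L has_real_derivative - (ln (1 - z) / z + ln z / (1 - z)) / 2) (at z)"
        using z assms by (intro has_real_derivative_rogers_L) auto
      have ratio: "P / (z * (1 - y) / w) * ((1 - y) / w\<^sup>2) = P / (z * w)"
        "P / ((1 - z) / w) * ((1 - y) / w\<^sup>2) = P * (1 - y) / ((1 - z) * w)"
        "P / (y * (1 - z) / w) * (y * (1 - y) / w\<^sup>2) = P * (1 - y) / ((1 - z) * w)"
        "P / ((1 - y) / w) * (y * (1 - y) / w\<^sup>2) = P * y / w"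
        "P / (z * y) * y = P / z" for P
        using z assms w by (simp_all add: power2_eq_square)
      \<comment> \<open>Once the logarithms are expanded, those of \<open>y\<close> and
        \<open>1 - y\<close> cancel, and those of \<open>1 - z\<close> and \<open>w\<close> enter
        only through their difference. These are the coefficients of that difference and of
        \<open>ln z\<close>.\<close>
      have coeff: "1 / z - 1 / (z * w) + y / w = 0"
        "1 / (1 - z) - y / w - (1 - y) / ((1 - z) * w) = 0"
        using z assms w by (simp_all add: field_simps) (simp_all add: w_def algebra_simps)
      have "- (ln (1 - z) / z + ln z / (1 - z)) / 2 + 0 - (- (ln w / (z * y) + ln (z * y) / w) / 2 * y
          + - (ln ((1 - z) / w) / (z * (1 - y) / w) + ln (z * (1 - y) / w) / ((1 - z) / w)) / 2
            * ((1 - y) / w\<^sup>2)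
          + - (ln ((1 - y) / w) / (y * (1 - z) / w) + ln (y * (1 - z) / w) / ((1 - y) / w)) / 2
            * (- (y * (1 - y)) / w\<^sup>2)) =
          - (ln (1 - z) / z + ln z / (1 - z)
            - (ln w / (z * y) * y + ln (z * y) / w * y
              + ln ((1 - z) / w) / (z * (1 - y) / w) * ((1 - y) / w\<^sup>2)
              + ln (z * (1 - y) / w) / ((1 - z) / w) * ((1 - y) / w\<^sup>2)
              - ln ((1 - y) / w) / (y * (1 - z) / w) * (y * (1 - y) / w\<^sup>2)
              - ln (y * (1 - z) / w) / ((1 - y) / w) * (y * (1 - y) / w\<^sup>2))) / 2"
        by (simp add: algebra_simps add_divide_distrib diff_divide_distrib)
      also have "\<dots> = - ((ln (1 - z) - ln w) * (1 / z - 1 / (z * w) + y / w)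
          + ln z * (1 / (1 - z) - y / w - (1 - y) / ((1 - z) * w))) / 2"
        unfolding ratio unfolding lnu lnv lnu' lnv' lnzy
        by (simp add: algebra_simps add_divide_distrib diff_divide_distrib)
      also have "\<dots> = 0"
        unfolding coeff by simp
      finally show ?thesis
        by (intro DERIV_cong[OF DERIV_diff[OF DERIV_add[OF dz DERIV_const]
              DERIV_add[OF DERIV_add[OF dp du] dv]]])
    qed
  qed
  then show ?thesis by simp
qed


section \<open>Periodic ideal polygons\<close>

text \<open>The five-term relation for \<open>p\<close>, \<open>q\<close>, \<open>r\<close>,
  \<open>s\<close> and infinity: each argument is a cross ratio omitting one of the five points. The
  case \<open>q = r\<close> is that of neighbouring edges of the polygon.\<close>

lemma rogers_L_pentagon:
  fixes p q r s :: real
  assumes "s < r" "r \<le> q" "q < p"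
  shows "rogers_L ((p - q) * (r - s) / ((p - r) * (q - s)))
      + rogers_L ((r - s) / (p - s)) + rogers_L ((p - q) / (p - s))
    = rogers_L ((p - q) / (p - r)) + rogers_L ((r - s) / (q - s))"
proof (cases "q = r")
  \<comment> \<open>Three of the arguments become 1, and the relation degenerates to the reflection
    formula.\<close>
  case True
  have eq: "(p - q) / (p - s) = 1 - (r - s) / (p - s)"
    using assms True by (simp add: field_simps)
  have "rogers_L ((r - s) / (p - s)) + rogers_L ((p - q) / (p - s)) = pi\<^sup>2 / 6"
    unfolding eq using assms True by (intro rogers_L_reflect) auto
  then show ?thesis
    using assms True by simp
next
  case False
  define x y where "x = (p - q) / (p - r)" and "y = (r - s) / (q - s)"
  have x1: "1 - x = (q - r) / (p - r)" and y1: "1 - y = (q - r) / (q - s)"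
    using assms by (simp_all add: x_def y_def field_simps)
  have xy: "x * y = (p - q) * (r - s) / ((p - r) * (q - s))"
    by (simp add: x_def y_def)
  have "1 - x * y = ((p - r) * (q - s) - (p - q) * (r - s)) / ((p - r) * (q - s))"
    unfolding xy using assms by (simp add: diff_divide_distrib)
  also have "(p - r) * (q - s) - (p - q) * (r - s) = (p - s) * (q - r)"
    by algebra
  finally have xy1: "1 - x * y = (p - s) * (q - r) / ((p - r) * (q - s))" .
  have u: "x * (1 - y) / (1 - x * y) = (p - q) / (p - s)"
    and v: "y * (1 - x) / (1 - x * y) = (r - s) / (p - s)"
    unfolding xy1 x1 y1 using assms False by (simp_all add: x_def y_def)
  have "rogers_L x + rogers_L y = rogers_L (x * y) +
      rogers_L (x * (1 - y) / (1 - x * y)) + rogers_L (y * (1 - x) / (1 - x * y))"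
    using assms False by (intro rogers_L_five_term) (auto simp: x_def y_def)
  then show ?thesis
    unfolding u v unfolding xy by (simp add: x_def y_def)
qed

text \<open>
  The cross ratio of the edges \<open>(t j, t (j + 1))\<close> and \<open>(t i, t (i + 1))\<close> of an ideal polygon.
\<close>

definition edge_ratio :: "(nat \<Rightarrow> real) \<Rightarrow> nat \<Rightarrow> nat \<Rightarrow> real" where
  "edge_ratio t j i = (t j - t (Suc j)) * (t i - t (Suc i)) / ((t j - t i) * (t (Suc j) - t (Suc i)))"

lemma edge_ratio_bounds:
  assumes dec: "\<And>i. t (Suc i) < t i" and "j < i"
  shows "0 \<le> edge_ratio t j i" "edge_ratio t j i \<le> 1"
proof -
  have mono: "t m \<le> t n" if "n \<le> m" for m n
    using lift_Suc_antimono_le[of t n m] dec that less_imp_le by blast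
  have "t (Suc i) < t i" "t i \<le> t (Suc j)" "t (Suc j) < t j"
    using dec mono \<open>j < i\<close> by auto
  \<comment> \<open>The denominator of the edge ratio minus its numerator factors as this
    product.\<close>
  moreover from this have "0 \<le> (t j - t (Suc i)) * (t (Suc j) - t i)" by simp
  then have "(t j - t (Suc j)) * (t i - t (Suc i)) \<le> (t j - t i) * (t (Suc j) - t (Suc i))"
    by (simp add: algebra_simps)
  ultimately show "0 \<le> edge_ratio t j i" "edge_ratio t j i \<le> 1"
    by (auto simp: edge_ratio_def divide_le_eq_1)
qed

text \<open>Adds the pentagon relations of the edge \<open>j\<close> with the edges
  \<open>j + 1\<close>, ..., \<open>j + n\<close>. The terms with numerator
  \<open>t j - t (Suc j)\<close> telescope; the others form the same sum for \<open>j\<close> and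
  for \<open>Suc j\<close>, up to a shift of the index by one. The constant is
  \<open>2 * rogers_L 1\<close>, from the two terms with argument 1 that remain at
  \<open>n = 0\<close>.\<close>

lemma rogers_L_edge_sum:
  fixes t :: "nat \<Rightarrow> real"
  assumes dec: "\<And>i. t (Suc i) < t i"
  shows "(\<Sum>k<n. rogers_L (edge_ratio t j (j + 1 + k)))
      + rogers_L ((t (j + n) - t (j + 1 + n)) / (t j - t (j + 1 + n)))
      + rogers_L ((t j - t (Suc j)) / (t j - t (j + 1 + n)))
      + (\<Sum>k<n. rogers_L ((t (j + k) - t (j + 1 + k)) / (t j - t (j + 1 + k))))
    = pi\<^sup>2 / 3 + (\<Sum>k<n. rogers_L ((t (Suc j + k) - t (Suc j + 1 + k)) / (t (Suc j) - t (Suc j + 1 + k))))"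
proof (induction n)
  case 0
  have "t (Suc j) < t j" by (rule dec)
  then show ?case by simp
next
  case (Suc n)
  have "t (j + 1 + n) \<le> t (Suc j)"
    by (rule lift_Suc_antimono_le[where f = t, OF less_imp_le[OF dec]]) simp
  from rogers_L_pentagon[OF dec[of "j + 1 + n"] this dec[of j]] show ?case
    using Suc.IH by (simp add: edge_ratio_def)
qed

theorem rogers_L_periodic_edges:
  fixes t :: "nat \<Rightarrow> real" and \<mu> :: real
  assumes dec: "\<And>i. t (Suc i) < t i" and lim: "t \<longlonglongrightarrow> 0"
    and per: "\<And>i. t (i + N) = \<mu> * t i"
  shows "\<And>j. j < N \<Longrightarrow> summable (\<lambda>k. rogers_L (edge_ratio t j (j + 1 + k)))"
    and "(\<Sum>j<N. \<Sum>k. rogers_L (edge_ratio t j (j + 1 + k)))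
      + (\<Sum>j<N. rogers_L (1 - t (Suc j) / t j)) = pi\<^sup>2 / 3 * real N"
proof -
  have mono: "t m \<le> t n" if "n \<le> m" for m n
    using lift_Suc_antimono_le[of t n m] dec that less_imp_le by blast
  have nonneg: "0 \<le> t i" for i
    using LIMSEQ_le_const2[OF lim, of "t i"] mono by blast
  have pos: "0 < t i" for i
    using nonneg[of "Suc i"] dec[of i] by linarith
  have lt: "t m < t n" if "n < m" for m n
    using mono[of "Suc n" m] dec[of n] that by simp
  have "\<mu> \<noteq> 0" using per[of 0] pos[of "0 + N"] by auto
  define S where "S j n = (\<Sum>k<n. rogers_L (edge_ratio t j (j + 1 + k)))" for j n
  define b where "b j k = (t (j + k) - t (j + 1 + k)) / (t j - t (j + 1 + k))" for j k
  define f where "f j n = (t j - t (Suc j)) / (t j - t (j + 1 + n))" for j n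
  define B where "B j n = (\<Sum>k<n. rogers_L (b j k))" for j n
  have bI: "b j k \<in> {0..1}" and fI: "f j k \<in> {0..1}" for j k
    using dec[of "j + k"] dec[of j] mono[of j "j + k"] mono[of "Suc j" "j + 1 + k"]
      lt[of j "j + 1 + k"]
    by (auto simp: b_def f_def divide_le_eq_1)
  have Bper: "B (j + N) n = B j n" for j n
  proof -
    have "t (j + N + k) = \<mu> * t (j + k)" "t (j + N + 1 + k) = \<mu> * t (j + 1 + k)" for k
      using per[of "j + k"] per[of "j + 1 + k"] by (simp_all add: algebra_simps)
    then have "b (j + N) k = b j k" for k
      using \<open>\<mu> \<noteq> 0\<close> by (simp add: b_def per flip: right_diff_distrib)
    then show ?thesis by (simp add: B_def)
  qed
  have step: "S j n + rogers_L (b j n) + rogers_L (f j n) + B j n = pi\<^sup>2 / 3 + B (Suc j) n" for j n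
    using rogers_L_edge_sum[where t = t and j = j and n = n, OF dec] unfolding S_def b_def f_def B_def .
  \<comment> \<open>The \<open>B\<close> terms cancel over a period already at finite
    \<open>n\<close>, so limits are taken only of what remains.\<close>
  have total: "(\<Sum>j<N. S j n) + (\<Sum>j<N. rogers_L (b j n)) + (\<Sum>j<N. rogers_L (f j n))
      = pi\<^sup>2 / 3 * real N" for n
  proof -
    have "(\<Sum>j<N. S j n) + (\<Sum>j<N. rogers_L (b j n)) + (\<Sum>j<N. rogers_L (f j n))
        = (\<Sum>j<N. S j n + rogers_L (b j n) + rogers_L (f j n))"
      by (simp add: sum.distrib)
    also have "\<dots> = (\<Sum>j<N. pi\<^sup>2 / 3 + (B (Suc j) n - B j n))"
    proof (rule sum.cong)
      show "S j n + rogers_L (b j n) + rogers_L (f j n) = pi\<^sup>2 / 3 + (B (Suc j) n - B j n)" for j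
        using step[of j n] by linarith
    qed simp
    also have "\<dots> = pi\<^sup>2 / 3 * real N + (B N n - B 0 n)"
      unfolding sum.distrib sum_lessThan_telescope[of "\<lambda>j. B j n"] by simp
    finally show ?thesis using Bper[of 0 n] by simp
  qed
  have term_nonneg: "0 \<le> rogers_L (edge_ratio t j (j + 1 + k))" for j k
    using edge_ratio_bounds[where t = t, OF dec] by (intro rogers_L_nonneg) auto
  have S_nonneg: "0 \<le> S j n" for j n
    unfolding S_def by (intro sum_nonneg term_nonneg)
  \<comment> \<open>All terms in \<open>total\<close> are nonnegative, so each partial sum is
    bounded by the constant, which gives summability.\<close>
  have bound: "S j n \<le> pi\<^sup>2 / 3 * real N" if "j < N" for j n
  proof -
    have "S j n \<le> (\<Sum>j<N. S j n)"
      using that by (intro member_le_sum) (auto simp: S_nonneg)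
    also have "\<dots> \<le> pi\<^sup>2 / 3 * real N"
      unfolding total[of n, symmetric] using bI fI
      by (intro add_increasing2 order_refl sum_nonneg rogers_L_nonneg) auto
    finally show ?thesis .
  qed
  show summ: "summable (\<lambda>k. rogers_L (edge_ratio t j (j + 1 + k)))" if "j < N" for j
    using bound[OF that] term_nonneg unfolding S_def by (intro summableI_nonneg_bounded)
  have limS: "(\<lambda>n. \<Sum>j<N. S j n) \<longlonglongrightarrow> (\<Sum>j<N. \<Sum>k. rogers_L (edge_ratio t j (j + 1 + k)))"
    unfolding S_def using summ by (intro tendsto_sum summable_LIMSEQ) auto
  have shift: "(\<lambda>n. t (j + 1 + n)) \<longlonglongrightarrow> 0" "(\<lambda>n. t (j + n)) \<longlonglongrightarrow> 0" for j
    using LIMSEQ_ignore_initial_segment[OF lim, of "j + 1"] LIMSEQ_ignore_initial_segment[OF lim, of j]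
    by (simp_all add: ac_simps)
  have limL: "(\<lambda>n. rogers_L (u n)) \<longlonglongrightarrow> rogers_L x" if "u \<longlonglongrightarrow> x" "\<And>n. u n \<in> {0..1}" for u x
  proof -
    have "x \<in> {0..1}" using closed_sequentially[OF closed_atLeastAtMost] that by blast
    then show ?thesis
      using continuous_on_tendsto_compose[OF continuous_on_rogers_L that(1)] that(2) by auto
  qed
  have limb: "(\<lambda>n. rogers_L (b j n)) \<longlonglongrightarrow> rogers_L 0" for j
  proof (rule limL[OF _ bI])
    have "(\<lambda>n. b j n) \<longlonglongrightarrow> (0 - 0) / (t j - 0)"
      unfolding b_def using pos[of j] by (intro tendsto_intros shift) auto
    then show "b j \<longlonglongrightarrow> 0" by simp
  qed
  have limf: "(\<lambda>n. rogers_L (f j n)) \<longlonglongrightarrow> rogers_L (1 - t (Suc j) / t j)" for j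
  proof (rule limL[OF _ fI])
    have "(\<lambda>n. f j n) \<longlonglongrightarrow> (t j - t (Suc j)) / (t j - 0)"
      unfolding f_def using pos[of j] by (intro tendsto_intros shift) auto
    then show "f j \<longlonglongrightarrow> 1 - t (Suc j) / t j"
      using pos[of j] by (simp add: diff_divide_distrib)
  qed
  have "(\<lambda>n. (\<Sum>j<N. S j n) + (\<Sum>j<N. rogers_L (b j n)) + (\<Sum>j<N. rogers_L (f j n))) \<longlonglongrightarrow>
      (\<Sum>j<N. \<Sum>k. rogers_L (edge_ratio t j (j + 1 + k))) + (\<Sum>j<N. rogers_L 0)
      + (\<Sum>j<N. rogers_L (1 - t (Suc j) / t j))"
    by (intro tendsto_add limS tendsto_sum limb limf)
  then have "(\<lambda>n::nat. pi\<^sup>2 / 3 * real N) \<longlonglongrightarrow>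
      (\<Sum>j<N. \<Sum>k. rogers_L (edge_ratio t j (j + 1 + k)))
      + (\<Sum>j<N. rogers_L (1 - t (Suc j) / t j))"
    unfolding total by simp
  from LIMSEQ_unique[OF this tendsto_const]
  show "(\<Sum>j<N. \<Sum>k. rogers_L (edge_ratio t j (j + 1 + k)))
      + (\<Sum>j<N. rogers_L (1 - t (Suc j) / t j)) = pi\<^sup>2 / 3 * real N" .
qed

text \<open>Sorts the second edge by the period it lies in: block 0 yields the finite sum, the
  blocks \<open>Suc k\<close> yield the infinite ones.\<close>

lemma suminf_split_blocks:
  fixes g :: "nat \<Rightarrow> real"
  assumes "summable (\<lambda>k. g (j + 1 + k))" "\<And>k. 0 \<le> g (j + 1 + k)" "j < N"
  shows "\<And>i. i < N \<Longrightarrow> summable (\<lambda>k. g (Suc k * N + i))"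
    and "(\<Sum>k. g (j + 1 + k)) = (\<Sum>i\<in>{j<..<N}. g i) + (\<Sum>i<N. \<Sum>k. g (Suc k * N + i))"
proof -
  \<comment> \<open>Extension by zero lets the blocks begin at multiples of \<open>N\<close>; since
    \<open>j < N\<close>, it affects block 0 only.\<close>
  define h where "h i = (if j < i then g i else 0)" for i
  have hg: "h (k + (j + 1)) = g (j + 1 + k)" for k by (simp add: h_def add.commute)
  have summ_h: "summable h"
    using assms(1) unfolding hg[symmetric] summable_iff_shift .
  have h_nonneg: "0 \<le> h i" for i
    using assms(2)[of "i - (j + 1)"] by (auto simp: h_def)
  have hN: "h (Suc k * N + i) = g (Suc k * N + i)" for k i
    using \<open>j < N\<close> by (simp add: h_def)
  have summ: "summable (\<lambda>k. h (k * N + i))" for i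
  proof -
    have "inj (\<lambda>k. k * N + i)" using \<open>j < N\<close> by (auto simp: inj_def)
    from summable_reindex[OF summ_h this h_nonneg] show ?thesis by (simp add: o_def)
  qed
  show "summable (\<lambda>k. g (Suc k * N + i))" if "i < N" for i
    using summable_Suc_iff[THEN iffD2, OF summ[of i]] unfolding hN .
  have "(\<Sum>k. g (j + 1 + k)) = suminf h"
    using suminf_split_initial_segment[OF summ_h, of "j + 1"] unfolding hg by (simp add: h_def)
  also have "\<dots> = (\<Sum>k. sum h {k * N..<k * N + N})"
    using sums_group[OF summable_sums[OF summ_h], of N] \<open>j < N\<close> by (simp add: sums_iff)
  also have "\<dots> = (\<Sum>k. \<Sum>i<N. h (k * N + i))"
    by (simp add: sum.atLeastLessThan_shift_0[of h] lessThan_atLeast0 add.commute)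
  also have "\<dots> = (\<Sum>i<N. \<Sum>k. h (k * N + i))"
    using summ by (intro suminf_sum)
  also have "\<dots> = (\<Sum>i<N. h i + (\<Sum>k. g (Suc k * N + i)))"
  proof (rule sum.cong)
    show "(\<Sum>k. h (k * N + i)) = h i + (\<Sum>k. g (Suc k * N + i))" for i
      using suminf_split_head[OF summ[of i]] unfolding hN by simp
  qed simp
  also have "\<dots> = (\<Sum>i<N. h i) + (\<Sum>i<N. \<Sum>k. g (Suc k * N + i))"
    by (rule sum.distrib)
  also have "(\<Sum>i<N. h i) = (\<Sum>i\<in>{j<..<N}. g i)"
    by (intro sum.mono_neutral_cong_right) (auto simp: h_def)
  finally show "(\<Sum>k. g (j + 1 + k)) = (\<Sum>i\<in>{j<..<N}. g i) + (\<Sum>i<N. \<Sum>k. g (Suc k * N + i))" .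
qed


section \<open>Convergents and Galois conjugates\<close>

text \<open>The defining recurrence appends a partial quotient at the end, whereas
  \<open>cf_trunc\<close> unfolds at the front; this mirror form links the two.\<close>

lemma cf_shift_rec:
  "cf_num_shift a (Suc n) = a 0 * cf_num_shift (\<lambda>i. a (Suc i)) n + cf_den_shift (\<lambda>i. a (Suc i)) n"
  "cf_den_shift a (Suc n) = cf_num_shift (\<lambda>i. a (Suc i)) n"
  by (induction n rule: induct_nat_012) (simp_all add: algebra_simps)

lemma cf_num_shift_pos:
  assumes "\<And>n. a n > 0"
  shows "cf_num_shift a (Suc n) > 0"
  by (induction n rule: induct_nat_012) (use assms in auto)

lemma cf_den_shift_pos:
  assumes "\<And>n. a n > 0"
  shows "cf_den_shift a (Suc (Suc n)) > 0"
  unfolding cf_shift_rec(2)[of a] by (rule cf_num_shift_pos) (rule assms)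

lemma cf_trunc_eq:
  assumes "\<And>n. a n > 0"
  shows "cf_trunc n a = real (cf_num_shift a (n + 2)) / real (cf_den_shift a (n + 2))"
  using assms
proof (induction n arbitrary: a)
  case (Suc n)
  let ?a = "\<lambda>i. a (Suc i)"
  have "cf_num_shift ?a (Suc (Suc n)) > 0"
    using Suc.prems by (intro cf_num_shift_pos)
  then show ?case
    using Suc.IH[of ?a] Suc.prems
    by (simp add: cf_shift_rec[of a "Suc (Suc n)"] field_simps del: cf_num_shift.simps cf_den_shift.simps)
qed simp

text \<open>For fixed \<open>m\<close> both sides satisfy the same recurrence in \<open>k\<close>;
  the case \<open>k = 1\<close> is the classical determinant of successive convergents. This is how
  numerators of cyclic permutations arise from the convergents of \<open>a\<close> itself.\<close>

lemma cf_shift_det: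
  "real (cf_num_shift a m) * real (cf_den_shift a (m + k))
    - real (cf_den_shift a m) * real (cf_num_shift a (m + k))
   = (- 1) ^ Suc m * real (cf_num_shift (cf_cyc m a) k)"
proof (induction k rule: induct_nat_012)
  case 1
  show ?case by (induction m) (simp_all add: algebra_simps)
next
  case (ge2 k)
  let ?d = "\<lambda>k. real (cf_num_shift a m) * real (cf_den_shift a (m + k))
    - real (cf_den_shift a m) * real (cf_num_shift a (m + k))"
  have "?d (Suc (Suc k)) = real (a (m + k)) * ?d (Suc k) + ?d k"
    by (simp add: algebra_simps)
  then show ?case
    unfolding ge2 by (simp add: cf_cyc_def algebra_simps)
qed simp

section \<open>Rational quadratics and Galois conjugates\<close>

lemma irreducible_quadratic_no_root:
  fixes f :: "'a::field poly"
  assumes deg: "degree f = 2" and no_root: "\<And>x. poly f x \<noteq> 0"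
  shows "irreducible f"
proof (rule irreducibleI)
  show "f \<noteq> 0" using deg by auto
  show "\<not> f dvd 1" using deg by (simp add: is_unit_iff_degree[OF \<open>f \<noteq> 0\<close>])
  show "g dvd 1 \<or> h dvd 1" if f: "f = g * h" for g h
  proof -
    have nz: "g \<noteq> 0" "h \<noteq> 0" using f \<open>f \<noteq> 0\<close> by auto
    have "degree g + degree h = 2" using deg f nz by (simp add: degree_mult_eq)
    moreover have "degree q \<noteq> 1" if "q dvd f" for q
    proof
      assume "degree q = 1"
      then have "coeff q 1 \<noteq> 0" using leading_coeff_0_iff[of q] by auto
      with \<open>degree q = 1\<close> have "poly q (- coeff q 0 / coeff q 1) = 0"
        by (simp add: poly_altdef)
      then show False using that no_root by (auto elim!: dvdE)
    qed
    then have "degree g \<noteq> 1" "degree h \<noteq> 1" using f by auto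
    ultimately have "degree g = 0 \<or> degree h = 0" by linarith
    then show ?thesis using nz by (auto simp: is_unit_iff_degree)
  qed
qed

lemma poly_degree_2:
  fixes f :: "rat poly" and x :: "'a::field_char_0"
  assumes "degree f = 2"
  shows "poly (map_poly of_rat f) x = of_rat (coeff f 0) + of_rat (coeff f 1) * x + of_rat (coeff f 2) * x\<^sup>2"
  using assms by (simp add: poly_altdef degree_map_poly coeff_map_poly numeral_2_eq_2 power2_eq_square)

text \<open>Since \<open>x\<close> is irrational, every rational quadratic vanishing at
  \<open>x\<close> is a multiple of \<open>[:q, - p, 1:]\<close>, so the root other than
  \<open>x\<close> is determined uniquely.\<close>

lemma galois_conj_eqI:
  fixes x y :: real and p q :: rat
  assumes irr: "x \<notin> \<rat>" and "y \<noteq> x"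
    and tr: "x + y = of_rat p" and nm: "x * y = of_rat q"
  shows "galois_conj x = y"
  unfolding galois_conj_def
proof (rule the_equality)
  have irry: "y \<notin> \<rat>"
    using irr tr by (metis Rats_diff Rats_of_rat add_diff_cancel_right')
  have factor: "(z - x) * (z - y) = z\<^sup>2 - of_rat p * z + of_rat q" for z
    using tr nm by (simp add: algebra_simps power2_eq_square flip: tr nm)
  let ?f = "[:q, - p, 1:]"
  have poly_f: "poly (map_poly of_rat ?f) z = (z - x) * (z - y)" for z
    unfolding factor by (simp add: map_poly_pCons of_rat_minus power2_eq_square algebra_simps)
  have "irreducible ?f"
  proof (rule irreducible_quadratic_no_root)
    show "poly ?f r \<noteq> 0" for r
    proof
      assume "poly ?f r = 0"
      then have "of_rat (poly ?f r) = (0 :: real)" by simp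
      then have "(of_rat r - x) * (of_rat r - y) = 0"
        unfolding factor by (simp add: of_rat_add of_rat_mult of_rat_minus of_rat_diff power2_eq_square algebra_simps)
      then show False using irr irry by (metis Rats_of_rat eq_iff_diff_eq_0 mult_eq_0_iff)
    qed
  qed simp
  moreover have "poly (map_poly of_rat ?f) x = 0" "poly (map_poly of_rat ?f) y = 0"
    by (simp_all only: poly_f) simp_all
  moreover have "degree ?f = 2" by simp
  ultimately show "y \<noteq> x \<and> (\<exists>f :: rat poly. irreducible f \<and> degree f = 2 \<and>
      poly (map_poly of_rat f) x = 0 \<and> poly (map_poly of_rat f) y = 0)"
    using \<open>y \<noteq> x\<close> by blast
next
  fix z :: real
  assume z: "z \<noteq> x \<and> (\<exists>f :: rat poly. irreducible f \<and> degree f = 2 \<and>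
      poly (map_poly of_rat f) x = 0 \<and> poly (map_poly of_rat f) z = 0)"
  then obtain f :: "rat poly" where deg: "degree f = 2"
    and fx: "poly (map_poly of_rat f) x = 0" and fz: "poly (map_poly of_rat f) z = 0" by blast
  define c0 c1 c2 where "c0 = coeff f 0" and "c1 = coeff f 1" and "c2 = coeff f 2"
  have "c2 \<noteq> 0" using deg by (metis c2_def degree_0 leading_coeff_0_iff zero_neq_numeral)
  have x0: "of_rat c0 + of_rat c1 * x + of_rat c2 * x\<^sup>2 = 0"
    and z0: "of_rat c0 + of_rat c1 * z + of_rat c2 * z\<^sup>2 = 0"
    using fx fz unfolding poly_degree_2[OF deg] c0_def c1_def c2_def by auto
  have x2: "x\<^sup>2 = of_rat p * x - of_rat q"
    using tr nm by (simp add: algebra_simps power2_eq_square flip: tr nm)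
  \<comment> \<open>Subtracting \<open>c2\<close> times the minimal polynomial leaves a linear
    relation, whose coefficients must vanish because \<open>x\<close> is irrational.\<close>
  have lin: "of_rat (c1 + c2 * p) * x = of_rat (c2 * q - c0)"
    using x0 unfolding x2 by (simp add: of_rat_add of_rat_mult of_rat_diff algebra_simps)
  have c1: "c1 + c2 * p = 0"
  proof (rule ccontr)
    assume "c1 + c2 * p \<noteq> 0"
    then have "x = of_rat ((c2 * q - c0) / (c1 + c2 * p))"
      using lin by (simp add: of_rat_divide field_simps)
    then show False using irr by (metis Rats_of_rat)
  qed
  have c0: "c0 = c2 * q" using lin unfolding c1 by simp
  have c1': "c1 = - (c2 * p)" using c1 by (simp add: eq_neg_iff_add_eq_0)
  have "of_rat c2 * (z\<^sup>2 - of_rat p * z + of_rat q) = 0"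
    using z0 unfolding c0 c1' by (simp add: of_rat_minus of_rat_mult algebra_simps)
  then have "z\<^sup>2 - of_rat p * z + of_rat q = 0" using \<open>c2 \<noteq> 0\<close> by simp
  then have "(z - x) * (z - y) = 0"
    by (simp add: algebra_simps power2_eq_square flip: tr nm)
  then show "z = y" using z by simp
qed


section \<open>Purely periodic continued fractions of even period\<close>

locale even_periodic_cf =
  fixes a :: "nat \<Rightarrow> nat" and l :: nat
  assumes l_pos: "l > 0" and l_even: "even l"
    and a_pos: "\<And>n. a n > 0"
    and a_per: "\<And>n. a (n + l) = a n"
begin

section \<open>The period matrix and its fixed points\<close>

abbreviation "P \<equiv> \<lambda>n. real (cf_num_shift a n)"
abbreviation "Q \<equiv> \<lambda>n. real (cf_den_shift a n)"

text \<open>The matrix with columns at \<open>Suc l\<close> and \<open>l\<close> represents the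
  automorphism. By periodicity both sides satisfy the same recurrence, and at
  \<open>n = 0, 1\<close> the vectors \<open>(P n, Q n)\<close> are the unit vectors.\<close>

lemma period_matrix:
  "P (n + l) = P (Suc l) * P n + P l * Q n"
  "Q (n + l) = Q (Suc l) * P n + Q l * Q n"
  by (induction n rule: induct_nat_012) (simp_all add: a_per algebra_simps)

lemma P_ge_1: "1 \<le> P (Suc n)"
  using cf_num_shift_pos[of a n] a_pos by (simp add: Suc_le_eq)

lemma Q_ge_1: "1 \<le> Q (Suc (Suc n))"
  using cf_den_shift_pos[of a n] a_pos by (simp add: Suc_le_eq del: cf_den_shift.simps)

lemma period_ge_1: "1 \<le> P (Suc l)" "1 \<le> P l" "1 \<le> Q (Suc l)" "1 \<le> Q l"
proof -
  \<comment> \<open>Evenness excludes \<open>l = 1\<close>, where \<open>Q l\<close> would be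
    0.\<close>
  have "l = Suc (Suc (l - 2))"
    using l_pos l_even by presburger
  then obtain m where "l = Suc (Suc m)" by blast
  then show "1 \<le> P (Suc l)" "1 \<le> P l" "1 \<le> Q (Suc l)" "1 \<le> Q l"
    using P_ge_1 Q_ge_1 by (simp_all del: cf_num_shift.simps cf_den_shift.simps)
qed

text \<open>The period matrix has determinant \<open>(- 1) ^ l\<close>, and \<open>l\<close> is
  even.\<close>

lemma period_det: "P (Suc l) * Q l = 1 + P l * Q (Suc l)"
  using cf_shift_det[of a l 1] l_even by (simp add: mult.commute)

text \<open>Trace and larger eigenvalue of the period matrix. The fixed points below come from its
  second row: an eigenvector \<open>(x, 1)\<close> with eigenvalue \<open>k\<close> satisfies
  \<open>Q (Suc l) * x + Q l = k\<close>.\<close>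

definition tr :: real where "tr = P (Suc l) + Q l"
definition lam :: real where "lam = (tr + sqrt (tr\<^sup>2 - 4)) / 2"
definition alpha :: real where "alpha = (lam - Q l) / Q (Suc l)"
definition alpha' :: real where "alpha' = (1 / lam - Q l) / Q (Suc l)"

text \<open>The diagonal entries are positive integers with product at least 2, so they are not both
  1. The automorphism is therefore hyperbolic.\<close>

lemma tr_ge_3: "3 \<le> tr"
proof -
  have "1 * 1 \<le> P l * Q (Suc l)"
    using period_ge_1 by (intro mult_mono) auto
  then have "2 \<le> P (Suc l) * Q l" using period_det by simp
  then have "P (Suc l) \<noteq> 1 \<or> Q l \<noteq> 1" by auto
  then have "cf_num_shift a (Suc l) \<noteq> 1 \<or> cf_den_shift a l \<noteq> 1" by auto
  then have "3 \<le> cf_num_shift a (Suc l) + cf_den_shift a l"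
    using period_ge_1 by (auto simp del: cf_num_shift.simps cf_den_shift.simps)
  then show ?thesis unfolding tr_def by linarith
qed

lemma lam_char: "lam * lam - tr * lam + 1 = 0"
proof -
  have "2 * 2 \<le> tr * tr" using tr_ge_3 by (intro mult_mono) auto
  then have "(sqrt (tr\<^sup>2 - 4))\<^sup>2 = tr\<^sup>2 - 4" by (simp add: power2_eq_square)
  then show ?thesis
    unfolding lam_def by (simp add: power2_eq_square field_simps)
qed

lemma lam_gt_1: "1 < lam"
proof -
  have "2 * 2 \<le> tr * tr" using tr_ge_3 by (intro mult_mono) auto
  then have "0 \<le> sqrt (tr\<^sup>2 - 4)" by (simp add: power2_eq_square)
  from add_mono[OF tr_ge_3 this] show ?thesis unfolding lam_def by simp
qed

lemma lam_sum: "lam + 1 / lam = tr"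
  using lam_char lam_gt_1 by (simp add: field_simps)

lemma alpha'_less: "alpha' < 0"
proof -
  have "1 / lam < 1" using lam_gt_1 by simp
  then show ?thesis
    using period_ge_1 unfolding alpha'_def by (intro divide_neg_pos) auto
qed

text \<open>The numbers \<open>lam - P (Suc l)\<close> and \<open>lam - Q l\<close> have a positive
  product and the positive sum \<open>lam - 1 / lam\<close>, so both are positive.\<close>

lemma alpha_pos: "0 < alpha"
proof -
  have "(lam - P (Suc l)) * (lam - Q l) = P l * Q (Suc l)"
    using lam_char period_det unfolding tr_def by (simp add: algebra_simps)
  moreover have "0 < P l * Q (Suc l)" using period_ge_1 by (intro mult_pos_pos) auto
  ultimately have *: "0 < (lam - P (Suc l)) * (lam - Q l)" by simp
  have "1 / lam < lam" using lam_gt_1 by (simp add: field_simps less_1_mult)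
  then have "0 < (lam - P (Suc l)) + (lam - Q l)"
    using lam_sum unfolding tr_def by simp
  with * have "0 < lam - Q l"
    by (smt (verit) zero_less_mult_iff)
  then show ?thesis
    using period_ge_1 unfolding alpha_def by (intro divide_pos_pos) auto
qed

lemma alpha_add: "alpha + alpha' = (P (Suc l) - Q l) / Q (Suc l)"
proof -
  have "alpha + alpha' = (lam + 1 / lam - 2 * Q l) / Q (Suc l)"
    unfolding alpha_def alpha'_def by (simp add: add_divide_distrib diff_divide_distrib)
  then show ?thesis unfolding lam_sum tr_def by simp
qed

lemma alpha_mult: "alpha * alpha' = - P l / Q (Suc l)"
proof -
  have "(lam - Q l) * (1 / lam - Q l) = 1 - Q l * (lam + 1 / lam) + Q l * Q l"
    using lam_gt_1 by (simp add: field_simps)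
  also have "\<dots> = - P l * Q (Suc l)"
    unfolding lam_sum tr_def using period_det by (simp add: algebra_simps)
  finally have "alpha * alpha' = (- P l * Q (Suc l)) / (Q (Suc l) * Q (Suc l))"
    unfolding alpha_def alpha'_def by simp
  then show ?thesis using period_ge_1(3) by simp
qed

text \<open>The linear forms that vanish at the two fixed points; they diagonalise the shift by a
  period.\<close>

definition gam :: "nat \<Rightarrow> real" where "gam n = P n - alpha * Q n"
definition bet :: "nat \<Rightarrow> real" where "bet n = P n - alpha' * Q n"

text \<open>A form vanishing on the eigenvector \<open>(x, 1)\<close> for \<open>k\<close> is a left
  eigenvector for the other eigenvalue \<open>tr - k\<close>. It suffices to compare the
  coefficients of \<open>P n\<close> and \<open>Q n\<close>.\<close>

lemma period_eigen:
  assumes "k * k - tr * k + 1 = 0" "x = (k - Q l) / Q (Suc l)"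
  shows "P (n + l) - x * Q (n + l) = (P n - x * Q n) * (tr - k)"
proof -
  have C: "x * Q (Suc l) = k - Q l" using assms(2) period_ge_1(3) by simp
  \<comment> \<open>Multiplying by \<open>Q (Suc l)\<close> allows \<open>x\<close> to be eliminated
    through \<open>C\<close>.\<close>
  have "Q (Suc l) * (P l - x * Q l) = P l * Q (Suc l) - (x * Q (Suc l)) * Q l"
    by (simp add: algebra_simps)
  also have "\<dots> = - (k - Q l) * (tr - k)"
    unfolding C using assms(1) period_det unfolding tr_def by (simp add: algebra_simps)
  also have "\<dots> = Q (Suc l) * (- x * (tr - k))"
    unfolding C[symmetric] by (simp add: algebra_simps)
  finally have B: "P l - x * Q l = - x * (tr - k)"
    using period_ge_1(3) by (subst (asm) mult_left_cancel) linarith+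
  have A: "P (Suc l) - x * Q (Suc l) = tr - k"
    unfolding C tr_def by simp
  have "P (n + l) - x * Q (n + l) = P n * (P (Suc l) - x * Q (Suc l)) + Q n * (P l - x * Q l)"
    unfolding period_matrix by (simp add: algebra_simps)
  then show ?thesis
    unfolding A B by (simp add: algebra_simps)
qed

lemma gam_per: "gam (n + l) = gam n / lam"
proof -
  have "tr - lam = 1 / lam" using lam_sum by simp
  with period_eigen[OF lam_char alpha_def, of n] show ?thesis
    unfolding gam_def by simp
qed

lemma bet_per: "bet (n + l) = bet n * lam"
proof -
  have "1 / lam * (1 / lam) - tr * (1 / lam) + 1 = 0"
    using lam_gt_1 unfolding lam_sum[symmetric] by (simp add: field_simps)
  moreover have "tr - 1 / lam = lam" using lam_sum by simp
  ultimately show ?thesis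
    using period_eigen[OF _ alpha'_def, of n] unfolding bet_def by simp
qed

lemma bet_ge_1: "1 \<le> bet (Suc n)"
proof -
  have "0 \<le> - alpha' * Q (Suc n)" using alpha'_less by (intro mult_nonneg_nonneg) auto
  then show ?thesis using P_ge_1[of n] unfolding bet_def by linarith
qed

text \<open>
  The convergents alternate around \<open>alpha\<close>. Their recurrence propagates this backwards, so it is
  enough to know it at the multiples of \<open>l\<close>.
\<close>

definition sgam :: "nat \<Rightarrow> real" where "sgam n = (- 1) ^ Suc n * gam n"

lemma sgam_rec: "sgam n = sgam (Suc (Suc n)) + real (a n) * sgam (Suc n)"
  unfolding sgam_def gam_def by (simp add: algebra_simps)

lemma sgam_mult: "sgam (l * k + n) = sgam n / lam ^ k"
proof (induction k)
  case (Suc k)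
  have "sgam (l * Suc k + n) = sgam ((l * k + n) + l)" by (simp add: algebra_simps)
  also have "\<dots> = sgam (l * k + n) / lam"
    unfolding sgam_def gam_per using l_even by (simp add: power_add)
  finally show ?case using Suc by simp
qed simp

lemma sgam_pos: "0 < sgam n"
proof -
  have "0 < sgam n \<and> 0 < sgam (Suc n)" if "n \<le> l * k" for k
    using that
  proof (induction n rule: inc_induct)
    case base
    have "sgam 0 = alpha" "sgam 1 = 1" by (simp_all add: sgam_def gam_def)
    then show ?case
      using sgam_mult[of k 0] sgam_mult[of k 1] alpha_pos lam_gt_1 by simp
  next
    case (step n)
    then show ?case using sgam_rec[of n] by (simp add: add_pos_nonneg)
  qed
  from this[of n] show ?thesis using l_pos by simp
qed

text \<open>The sequence decreases because \<open>a n\<close> is at least 1, and it decays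
  geometrically along the multiples of \<open>l\<close>.\<close>

lemma sgam_lim: "sgam \<longlonglongrightarrow> 0"
proof -
  have "sgam (Suc n) \<le> sgam n" for n
  proof -
    have "1 * sgam (Suc n) \<le> real (a n) * sgam (Suc n)"
      using a_pos[of n] sgam_pos[of "Suc n"] by (intro mult_right_mono) auto
    then show ?thesis using sgam_rec[of n] sgam_pos[of "Suc (Suc n)"] by linarith
  qed
  then have "decseq sgam" by (rule decseq_SucI)
  then obtain L where L: "sgam \<longlonglongrightarrow> L"
    using decseq_convergent[of sgam 0] sgam_pos less_imp_le by metis
  have "strict_mono (\<lambda>k. l * k)" using l_pos by (auto simp: strict_mono_def)
  from LIMSEQ_subseq_LIMSEQ[OF L this] have "(\<lambda>k. sgam 0 / lam ^ k) \<longlonglongrightarrow> L"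
    using sgam_mult[of _ 0] by (simp add: o_def)
  moreover have "(\<lambda>k. sgam 0 / lam ^ k) \<longlonglongrightarrow> 0"
    using lam_gt_1 by (intro LIMSEQ_divide_realpow_zero)
  ultimately show ?thesis using L LIMSEQ_unique by blast
qed

lemma abs_gam: "\<bar>gam n\<bar> = sgam n"
  using sgam_pos[of n] unfolding sgam_def by (cases "even n") auto

section \<open>The value of the continued fraction, its irrationality and its conjugate\<close>

lemma cf_value_eq: "cf_value a = alpha"
proof -
  have "(\<lambda>n. cf_trunc n a - alpha) \<longlonglongrightarrow> 0"
  proof (rule Lim_null_comparison)
    show "(\<lambda>n. sgam (n + 2)) \<longlonglongrightarrow> 0"
      using LIMSEQ_ignore_initial_segment[OF sgam_lim] .
    have "norm (cf_trunc n a - alpha) \<le> sgam (n + 2)" for n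
    proof -
      have Q: "1 \<le> Q (n + 2)" using Q_ge_1[of n] by (simp del: cf_den_shift.simps)
      then have "cf_trunc n a - alpha = gam (n + 2) / Q (n + 2)"
        unfolding cf_trunc_eq[OF a_pos] gam_def by (simp add: diff_divide_distrib)
      also have "norm \<dots> = sgam (n + 2) / Q (n + 2)"
        by (simp add: abs_gam del: cf_den_shift.simps)
      also have "\<dots> \<le> sgam (n + 2)"
        using Q sgam_pos[of "n + 2"] by (simp add: divide_le_eq_1 field_simps del: cf_den_shift.simps)
      finally show ?thesis .
    qed
    then show "\<forall>\<^sub>F n in sequentially. norm (cf_trunc n a - alpha) \<le> sgam (n + 2)"
      by (intro always_eventually allI)
  qed
  then have "(\<lambda>n. cf_trunc n a) \<longlonglongrightarrow> alpha" by (rule LIM_zero_cancel)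
  then show ?thesis unfolding cf_value_def by (rule limI)
qed

text \<open>If \<open>alpha\<close> were \<open>p / q\<close>, the numbers \<open>q * gam n\<close>
  would be nonzero integers tending to 0.\<close>

lemma alpha_irrational: "alpha \<notin> \<rat>"
proof
  assume "alpha \<in> \<rat>"
  then obtain p q :: int where q: "q > 0" and eq: "alpha = of_int p / of_int q"
    by (metis Rats_cases')
  have "1 \<le> of_int q * sgam n" for n
  proof -
    have int_eq: "of_int q * gam n = of_int (q * int (cf_num_shift a n) - p * int (cf_den_shift a n))"
      using q unfolding gam_def eq by (simp add: field_simps)
    have "of_int q * gam n \<noteq> 0" using q abs_gam[of n] sgam_pos[of n] by auto
    then have "1 \<le> \<bar>of_int q * gam n\<bar>"
      unfolding int_eq by (simp only: of_int_eq_0_iff flip: of_int_abs)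
    then show ?thesis using q by (simp add: abs_mult abs_gam)
  qed
  moreover have "(\<lambda>n. of_int q * sgam n) \<longlonglongrightarrow> of_int q * 0"
    by (intro tendsto_intros sgam_lim)
  ultimately have "1 \<le> of_int q * (0 :: real)"
    by (intro LIMSEQ_le_const) auto
  then show False by simp
qed

lemma galois_conj_alpha: "galois_conj alpha = alpha'"
proof (rule galois_conj_eqI)
  show "alpha \<notin> \<rat>" by (rule alpha_irrational)
  show "alpha' \<noteq> alpha" using alpha_pos alpha'_less by simp
  show "alpha + alpha' = of_rat ((of_nat (cf_num_shift a (Suc l)) - of_nat (cf_den_shift a l))
      / of_nat (cf_den_shift a (Suc l)))"
    unfolding alpha_add by (simp add: of_rat_divide of_rat_diff)
  show "alpha * alpha' = of_rat (- of_nat (cf_num_shift a l) / of_nat (cf_den_shift a (Suc l)))"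
    unfolding alpha_mult by (simp add: of_rat_divide of_rat_minus)
qed

text \<open>
  The coordinate of the odd convergent of index \<open>2 * i - 1\<close> that puts the Galois conjugate at
  infinity and \<open>alpha\<close> at the origin, so that the automorphism becomes a dilation.
\<close>

definition pt :: "nat \<Rightarrow> real" where
  "pt i = gam (2 * i + 1) / bet (2 * i + 1)"

text \<open>For \<open>j \<le> i\<close> this is the determinant of the vectors
  \<open>(P, Q)\<close> at \<open>2 * j + 1\<close> and \<open>2 * i + 1\<close>. In terms of
  \<open>cf_p\<close> its index is \<open>2 * i - 2 * j - 2\<close>.\<close>

definition minor :: "nat \<Rightarrow> nat \<Rightarrow> real" where
  "minor j i = real (cf_num_shift (cf_cyc (2 * j + 1) a) (2 * (i - j)))"

lemma bet_pos: "0 < bet (2 * i + 1)"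
  using bet_ge_1[of "2 * i"] by simp

lemma gam_pos: "0 < gam (2 * i + 1)"
  using sgam_pos[of "2 * i + 1"] unfolding sgam_def by simp

lemma minor_pos: "j < i \<Longrightarrow> 0 < minor j i"
  using cf_num_shift_pos[of "cf_cyc (2 * j + 1) a" "2 * (i - j) - 1"] a_pos
  by (simp add: minor_def cf_cyc_def)

lemma minor_Suc: "minor i (Suc i) = real (a (2 * i + 1))"
  by (simp add: minor_def cf_cyc_def numeral_2_eq_2)

text \<open>Passing from \<open>(P, Q)\<close> to \<open>(gam, bet)\<close> multiplies determinants
  by \<open>alpha - alpha'\<close>.\<close>

lemma gam_bet_minor:
  assumes "j \<le> i"
  shows "gam (2 * j + 1) * bet (2 * i + 1) - gam (2 * i + 1) * bet (2 * j + 1)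
    = (alpha - alpha') * minor j i"
proof -
  have "2 * j + 1 + 2 * (i - j) = 2 * i + 1" using assms by simp
  with cf_shift_det[of a "2 * j + 1" "2 * (i - j)"]
  have "P (2 * j + 1) * Q (2 * i + 1) - Q (2 * j + 1) * P (2 * i + 1) = minor j i"
    by (simp add: minor_def del: cf_num_shift.simps cf_den_shift.simps)
  then show ?thesis
    unfolding gam_def bet_def by (simp only: flip: \<open>_ = minor j i\<close>) (simp add: algebra_simps)
qed

lemma pt_diff:
  assumes "j \<le> i"
  shows "pt j - pt i = (alpha - alpha') * minor j i / (bet (2 * j + 1) * bet (2 * i + 1))"
  using bet_pos[of i] bet_pos[of j] unfolding pt_def gam_bet_minor[OF assms, symmetric]
  by (simp add: field_simps)

lemma pt_dec: "pt (Suc i) < pt i"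
proof -
  have "0 < pt i - pt (Suc i)"
    using minor_pos[of i "Suc i"] bet_pos[of i] bet_pos[of "Suc i"] alpha_pos alpha'_less
    by (subst pt_diff) (auto intro!: divide_pos_pos mult_pos_pos)
  then show ?thesis by simp
qed

lemma pt_lim: "pt \<longlonglongrightarrow> 0"
proof (rule Lim_null_comparison)
  show "(\<lambda>i. sgam (2 * i + 1)) \<longlonglongrightarrow> 0"
    using LIMSEQ_subseq_LIMSEQ[OF sgam_lim, of "\<lambda>i. 2 * i + 1"]
    by (simp add: o_def strict_mono_def)
  have "norm (pt i) \<le> sgam (2 * i + 1)" for i
    using bet_ge_1[of "2 * i"] sgam_pos[of "2 * i + 1"] abs_gam[of "2 * i + 1"]
    unfolding pt_def by (simp add: field_simps)
  then show "\<forall>\<^sub>F i in sequentially. norm (pt i) \<le> sgam (2 * i + 1)"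
    by (intro always_eventually allI)
qed

lemma pt_per: "pt (i + l div 2) = 1 / lam\<^sup>2 * pt i"
proof -
  have "2 * (i + l div 2) + 1 = 2 * i + 1 + l" using l_even by simp
  then show ?thesis
    unfolding pt_def by (simp only: gam_per bet_per) (simp add: power2_eq_square)
qed

text \<open>In \<open>pt_diff\<close> the factors \<open>bet\<close> and
  \<open>alpha - alpha'\<close> occur equally often above and below the fraction bar, so only the
  minors survive.\<close>

lemma edge_ratio_pt:
  assumes "j < i"
  shows "edge_ratio pt j i = minor j (Suc j) * minor i (Suc i) / (minor j i * minor (Suc j) (Suc i))"
proof -
  have "alpha - alpha' \<noteq> 0" using alpha_pos alpha'_less by simp
  then show ?thesis
    unfolding edge_ratio_def
    using assms bet_pos[of i] bet_pos[of j] bet_pos[of "Suc i"] bet_pos[of "Suc j"]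
    by (simp add: pt_diff)
qed

text \<open>The case \<open>k = 0\<close> serves the first sum of the theorem, and positive
  \<open>k\<close> the second: the second edge is moved by \<open>k\<close> periods.\<close>

lemma dilog_arg_eq:
  assumes "j < k * (l div 2) + i"
  shows "dilog_arg a i j (int k * int l + 2 * int i - 2 * int j - 2) = edge_ratio pt j (k * (l div 2) + i)"
proof -
  have "int k * int l = 2 * (int k * int (l div 2))" using l_even by auto
  \<comment> \<open>The summand 2 is the index shift of \<open>cf_p\<close>; by the assumption the
    shifted index is positive, so \<open>nat\<close> loses nothing.\<close>
  then have "int k * int l + 2 * int i - 2 * int j - 2 + 2 = int (2 * (k * (l div 2) + i - j))"
    using assms by (simp only: of_nat_mult of_nat_diff[OF less_imp_le] of_nat_add) simp
  then have *: "nat (int k * int l + 2 * int i - 2 * int j - 2 + 2) = 2 * (k * (l div 2) + i - j)"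
    by (simp only: nat_int)
  have "a (n + l * k) = a n" for n
  proof (induction k)
    case (Suc k)
    then show ?case using a_per[of "n + l * k"] by (simp add: algebra_simps)
  qed simp
  from this[of "2 * i + 1"] have "a (2 * (k * (l div 2) + i) + 1) = a (2 * i + 1)"
    using l_even by (simp add: algebra_simps flip: mult.assoc)
  then show ?thesis
    unfolding edge_ratio_pt[OF assms] minor_Suc dilog_arg_def cf_p_def *
    by (simp add: minor_def mult.commute numeral_3_eq_3)
qed

text \<open>In the coordinate of \<open>pt\<close> the four points are infinity, 0,
  \<open>pt (Suc m)\<close> and \<open>pt m\<close>, and the cross ratio is invariant under this
  change of coordinate.\<close>

lemma cross_ratio_eq:
  "cross_ratio (Fin alpha') (Fin alpha) (convergent_pt a (2 * int m + 1)) (convergent_pt a (2 * int m - 1))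
    = 1 - pt (Suc m) / pt m"
proof -
  have idx: "nat (2 * int m + 1 + 2) = 2 * Suc m + 1" "nat (2 * int m - 1 + 2) = 2 * m + 1" by auto
  have Q3: "Q (2 * Suc m + 1) \<noteq> 0" using Q_ge_1[of "2 * m + 1"] by (simp del: cf_den_shift.simps)
  define z where "z k = P (2 * k + 1) / Q (2 * k + 1)" for k
  have pos: "0 < gam (2 * m + 1)" "0 < bet (2 * Suc m + 1)" "0 < bet (2 * m + 1)"
    using gam_pos[of m] bet_pos[of "Suc m"] bet_pos[of m] by auto
  have gb: "gam (2 * k + 1) = Q (2 * k + 1) * (z k - alpha)"
    "bet (2 * k + 1) = Q (2 * k + 1) * (z k - alpha')" if "Q (2 * k + 1) \<noteq> 0" for k
    using that unfolding gam_def bet_def z_def by (simp_all add: algebra_simps)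
  have z3: "convergent_pt a (2 * int m + 1) = Fin (z (Suc m))"
    using Q3 unfolding convergent_pt_def cf_q_def cf_p_def idx z_def
    by (simp del: cf_num_shift.simps cf_den_shift.simps)
  have nz3: "z (Suc m) - alpha' \<noteq> 0" using pos(2) gb(2)[OF Q3] by auto
  show ?thesis
  proof (cases "m = 0")
    \<comment> \<open>The convergent of index -1 is infinity, whose coordinate is 1.\<close>
    case True
    have z4: "convergent_pt a (2 * int m - 1) = Infty"
      using True unfolding convergent_pt_def cf_q_def cf_p_def idx by simp
    have "pt m = 1" using True by (simp add: pt_def gam_def bet_def)
    moreover have "pt (Suc m) = (z (Suc m) - alpha) / (z (Suc m) - alpha')"
      using Q3 unfolding pt_def gb[OF Q3] by (simp del: cf_den_shift.simps)
    ultimately show ?thesis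
      using nz3 unfolding z3 z4 cross_ratio_def by (simp add: field_simps)
  next
    case False
    then have Q4: "Q (2 * m + 1) \<noteq> 0"
      using Q_ge_1[of "2 * m - 1"] by (cases m) (simp_all del: cf_den_shift.simps)
    have z4: "convergent_pt a (2 * int m - 1) = Fin (z m)"
      using Q4 unfolding convergent_pt_def cf_q_def cf_p_def idx z_def
      by (simp del: cf_num_shift.simps cf_den_shift.simps)
    have nz4: "z m - alpha \<noteq> 0" "z m - alpha' \<noteq> 0"
      using pos(1,3) gb[OF Q4] by auto
    have pts: "pt m = (z m - alpha) / (z m - alpha')"
      "pt (Suc m) = (z (Suc m) - alpha) / (z (Suc m) - alpha')"
      using Q3 Q4 unfolding pt_def gb[OF Q3] gb[OF Q4] by (simp_all del: cf_den_shift.simps)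
    have "1 - pt (Suc m) / pt m
        = 1 - (z (Suc m) - alpha) * (z m - alpha') / ((z (Suc m) - alpha') * (z m - alpha))"
      unfolding pts by simp
    also have "\<dots> = ((z (Suc m) - alpha') * (z m - alpha) - (z (Suc m) - alpha) * (z m - alpha'))
        / ((z (Suc m) - alpha') * (z m - alpha))"
      using nz3 nz4 by (simp add: diff_divide_distrib)
    also have "\<dots> = (- ((alpha' - alpha) * (z m - z (Suc m)))) / (- ((alpha' - z (Suc m)) * (z m - alpha)))"
      by (intro arg_cong2[of _ _ _ _ "(/)"]) algebra+
    also have "\<dots> = (alpha' - alpha) * (z m - z (Suc m)) / ((alpha' - z (Suc m)) * (z m - alpha))"
      by (rule minus_divide_divide)
    finally show ?thesis
      unfolding z3 z4 cross_ratio_def pdiff.simps by (rule sym)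
  qed
qed

end

theorem theorem15p3:
  fixes a :: "nat \<Rightarrow> nat" and l :: nat
  assumes "l > 0" and "even l"
    and "\<And>n. a n > 0"
    and "\<And>n. a (n + l) = a n"
  shows "(\<forall>j < l div 2. \<forall>i < l div 2.
            summable (\<lambda>k. rogers_L (dilog_arg a i j
              (int (Suc k) * int l + 2 * int i - 2 * int j - 2)))) \<and>
         (\<Sum>i<l div 2. \<Sum>j<i. rogers_L (dilog_arg a i j (2 * int i - 2 * int j - 2)))
       + (\<Sum>j<l div 2. \<Sum>i<l div 2. \<Sum>k. rogers_L (dilog_arg a i j
              (int (Suc k) * int l + 2 * int i - 2 * int j - 2)))
       + (\<Sum>m<l div 2. rogers_L (cross_ratio
              (Fin (galois_conj (cf_value a))) (Fin (cf_value a))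
              (convergent_pt a (2 * int m + 1)) (convergent_pt a (2 * int m - 1))))
       = pi\<^sup>2 * real l / 6"
proof -
  interpret even_periodic_cf a l by unfold_locales (use assms in auto)
  define N where "N = l div 2"
  have l: "real l = 2 * real N" using l_even by (auto simp: N_def)
  define g where "g j i = rogers_L (edge_ratio pt j i)" for j i
  \<comment> \<open>Since \<open>j < N\<close>, every edge of a block \<open>Suc k\<close> comes
    after the edge \<open>j\<close>.\<close>
  have later: "rogers_L (dilog_arg a i j (int (Suc k) * int l + 2 * int i - 2 * int j - 2))
      = g j (Suc k * N + i)" if "j < N" for i j k
    using dilog_arg_eq[of j "Suc k" i] that unfolding g_def N_def by simp
  have first: "rogers_L (dilog_arg a i j (2 * int i - 2 * int j - 2)) = g j i" if "j < i" for i j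
    using dilog_arg_eq[of j 0 i] that unfolding g_def by simp
  note sums = rogers_L_periodic_edges[where t = pt, OF pt_dec pt_lim pt_per, folded N_def g_def]
  have nonneg: "0 \<le> g j (j + 1 + k)" for j k
    unfolding g_def using edge_ratio_bounds[where t = pt, OF pt_dec] by (intro rogers_L_nonneg) auto
  note blocks = suminf_split_blocks[where g = "g j" and j = j and N = N for j, OF sums(1) nonneg]
  have "(\<Sum>j<N. \<Sum>k. g j (j + 1 + k))
      = (\<Sum>j<N. \<Sum>i | i \<in> {..<N} \<and> j < i. g j i) + (\<Sum>j<N. \<Sum>i<N. \<Sum>k. g j (Suc k * N + i))"
    unfolding sum.distrib[symmetric]
  proof (rule sum.cong)
    fix j assume "j \<in> {..<N}"
    moreover have "{j<..<N} = {i. i \<in> {..<N} \<and> j < i}" by auto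
    ultimately show "(\<Sum>k. g j (j + 1 + k))
        = (\<Sum>i | i \<in> {..<N} \<and> j < i. g j i) + (\<Sum>i<N. \<Sum>k. g j (Suc k * N + i))"
      using blocks(2)[of j] by simp
  qed simp
  \<comment> \<open>The first sum of the theorem has the later edge \<open>i\<close> outside, so the
    triangular sum is exchanged.\<close>
  also have "(\<Sum>j<N. \<Sum>i | i \<in> {..<N} \<and> j < i. g j i) = (\<Sum>i<N. \<Sum>j | j \<in> {..<N} \<and> j < i. g j i)"
    by (rule sum.swap_restrict) auto
  also have "\<dots> = (\<Sum>i<N. \<Sum>j<i. g j i)"
    by (intro sum.cong) auto
  finally have split: "(\<Sum>j<N. \<Sum>k. g j (j + 1 + k))
      = (\<Sum>i<N. \<Sum>j<i. g j i) + (\<Sum>j<N. \<Sum>i<N. \<Sum>k. g j (Suc k * N + i))" .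
  have "summable (\<lambda>k. g j (Suc k * N + i))" if "j < N" "i < N" for i j
    using blocks(1)[of j i] that by blast
  moreover have "(\<Sum>i<N. \<Sum>j<i. g j i) + (\<Sum>j<N. \<Sum>i<N. \<Sum>k. g j (Suc k * N + i))
      + (\<Sum>m<N. rogers_L (1 - pt (Suc m) / pt m)) = pi\<^sup>2 * real l / 6"
    using sums(2) unfolding split l by simp
  ultimately show ?thesis
    unfolding cf_value_eq galois_conj_alpha cross_ratio_eq N_def[symmetric]
    by (simp add: later first del: of_nat_Suc mult_Suc)
qed

end
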